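(* Let $\mathbf X=(X,\lambda_X)$ and $\mathbf Y=(Y,\lambda_Y)$ be topological left unosemigroups and let $I\subset X$ be a closed two-sided ideal of $X$ with $\lambda_X(I)\subset I$. If $\mathbf X$ and $\mathbf Y$ are ditopological left unosemigroups, then so is their reduced product $\mathbf X\times_I\mathbf Y=(X\times_I Y,\lambda)$.
   Context: A topological semigroup is a non-empty topological space $S$ endowed with a continuous associative binary operation $\cdot:S\times S\to S$. A left unit operation on $S$ is a map $\lambda:S\to S$ with $\lambda(x)\cdot x=x$ for all $x\in S$. A topological left unosemigroup $(S,\lambda)$ is a topological semigroup $S$ with a continuous left unit operation $\lambda$. For $A,B\subset S$ put $A\leftthreetimes B=\{x\in S: ax\in B \text{ for some } a\in A\}$. A continuous left unit operation $\lambda$ is dicontinuous if for every $x\in S$ and every neighborhood $O_x\subset S$ of $x$ there are a neighborhood $U_x\subset S$ of $x$ and a neighborhood $W_{\lambda(x)}\subset\lambda(S)$ of $\lambda(x)$ in the subspace $\lambda(S)$ such that $(W_{\lambda(x)}\leftthreetimes U_x)\cap\lambda^{-1}(W_{\lambda(x)})\subset O_x$. A topological left unosemigroup $(S,\lambda)$ is ditopological if $\lambda$ is dicontinuous. Reduced product: for topological semigroups $X,Y$ and a closed two-sided ideal $I\subset X$, $X\times_I Y$ is the set $I\cup((X\setminus I)\times Y)$ with the smallest topology such that the inclusion $(X\setminus I)\times Y\hookrightarrow X\times_I Y$ is a topological embedding and the projection $\pi:X\times_I Y\to X$, $\pi(z)=z$ for $z\in I$ and $\pi(x,y)=x$ for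 $(x,y)\in(X\setminus I)\times Y$, is continuous. Its semigroup operation is the unique binary operation making the map $q:X\times Y\to X\times_I Y$, $q(x,y)=x$ if $x\in I$ and $q(x,y)=(x,y)$ otherwise, a semigroup homomorphism. If $\lambda_X(I)\subset I$, the left unit operation $\lambda$ on $X\times_I Y$ is given by $\lambda(z)=\lambda_X(z)$ for $z\in I$ and $\lambda(x,y)=(\lambda_X(x),\lambda_Y(y))$ for $(x,y)\in(X\setminus I)\times Y$ (well defined, since $\lambda_X(x)\notin I$ when $x\notin I$); $(X\times_I Y,\lambda)$ is a topological left unosemigroup. *)

theory Defs
  imports "HOL-Analysis.Analysis"
begin

text \<open>
  Spaces are abstract topologies and the operations are total functions on the ambient type;
  only their values on the carrier \<open>topspace S\<close> matter. Closure of the carrier under the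
  operations is part of \<^const>\<open>continuous_map\<close>.
\<close>

definition topological_semigroup :: "'a topology \<Rightarrow> ('a \<Rightarrow> 'a \<Rightarrow> 'a) \<Rightarrow> bool" where
  "topological_semigroup S m \<longleftrightarrow>
     topspace S \<noteq> {} \<and>
     continuous_map (prod_topology S S) S (\<lambda>(x, y). m x y) \<and>
     (\<forall>x\<in>topspace S. \<forall>y\<in>topspace S. \<forall>z\<in>topspace S. m (m x y) z = m x (m y z))"

definition topological_left_unosemigroup ::
    "'a topology \<Rightarrow> ('a \<Rightarrow> 'a \<Rightarrow> 'a) \<Rightarrow> ('a \<Rightarrow> 'a) \<Rightarrow> bool" where
  "topological_left_unosemigroup S m l \<longleftrightarrow>
     topological_semigroup S m \<and>
     continuous_map S S l \<and>
     (\<forall>x\<in>topspace S. m (l x) x = x)"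

definition left_div :: "'a topology \<Rightarrow> ('a \<Rightarrow> 'a \<Rightarrow> 'a) \<Rightarrow> 'a set \<Rightarrow> 'a set \<Rightarrow> 'a set" where
  "left_div S m A B = {x \<in> topspace S. \<exists>a\<in>A. m a x \<in> B}"

text \<open>Neighborhoods are taken to be open. By monotonicity of the left-hand side in \<open>U\<close>
  and \<open>W\<close>, arbitrary neighborhoods would give the same notion.\<close>

definition dicontinuous :: "'a topology \<Rightarrow> ('a \<Rightarrow> 'a \<Rightarrow> 'a) \<Rightarrow> ('a \<Rightarrow> 'a) \<Rightarrow> bool" where
  "dicontinuous S m l \<longleftrightarrow>
     (\<forall>x\<in>topspace S. \<forall>V. openin S V \<and> x \<in> V \<longrightarrow>
        (\<exists>U W. openin S U \<and> x \<in> U \<and>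
               openin (subtopology S (l ` topspace S)) W \<and> l x \<in> W \<and>
               left_div S m W U \<inter> {z \<in> topspace S. l z \<in> W} \<subseteq> V))"

definition ditopological_left_unosemigroup ::
    "'a topology \<Rightarrow> ('a \<Rightarrow> 'a \<Rightarrow> 'a) \<Rightarrow> ('a \<Rightarrow> 'a) \<Rightarrow> bool" where
  "ditopological_left_unosemigroup S m l \<longleftrightarrow>
     topological_left_unosemigroup S m l \<and> dicontinuous S m l"

definition two_sided_ideal :: "'a topology \<Rightarrow> ('a \<Rightarrow> 'a \<Rightarrow> 'a) \<Rightarrow> 'a set \<Rightarrow> bool" where
  "two_sided_ideal S m I \<longleftrightarrow>
     I \<subseteq> topspace S \<and> (\<forall>x\<in>topspace S. \<forall>z\<in>I. m x z \<in> I \<and> m z x \<in> I)"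

text \<open>The disjoint union \<open>I \<union> ((X - I) \<times> Y)\<close> lives in a sum type: \<open>Inl z\<close> is the point
  \<open>z \<in> I\<close> and \<open>Inr (x, y)\<close> is the pair \<open>(x, y)\<close> with \<open>x \<notin> I\<close>.\<close>

definition reduced_carrier :: "'a topology \<Rightarrow> 'b topology \<Rightarrow> 'a set \<Rightarrow> ('a + 'a \<times> 'b) set" where
  "reduced_carrier X Y I = Inl ` I \<union> Inr ` ((topspace X - I) \<times> topspace Y)"

definition reduced_proj :: "'a + 'a \<times> 'b \<Rightarrow> 'a" where
  "reduced_proj u = (case u of Inl z \<Rightarrow> z | Inr p \<Rightarrow> fst p)"

definition reduced_quot :: "'a set \<Rightarrow> 'a \<times> 'b \<Rightarrow> 'a + 'a \<times> 'b" where
  "reduced_quot I p = (if fst p \<in> I then Inl (fst p) else Inr p)"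

definition reduced_admissible ::
    "'a topology \<Rightarrow> 'b topology \<Rightarrow> 'a set \<Rightarrow> ('a + 'a \<times> 'b) topology \<Rightarrow> bool" where
  "reduced_admissible X Y I T \<longleftrightarrow>
     topspace T = reduced_carrier X Y I \<and>
     embedding_map (prod_topology (subtopology X (topspace X - I)) Y) T Inr \<and>
     continuous_map T X reduced_proj"

definition reduced_topology ::
    "'a topology \<Rightarrow> 'b topology \<Rightarrow> 'a set \<Rightarrow> ('a + 'a \<times> 'b) topology" where
  "reduced_topology X Y I =
     (THE T. reduced_admissible X Y I T \<and>
        (\<forall>T'. reduced_admissible X Y I T' \<longrightarrow> (\<forall>U. openin T U \<longrightarrow> openin T' U)))"

text \<open>The operation is written out explicitly; \<open>reduced_mult_unique\<close> below shows that on the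
  carrier it is the unique operation for which \<^const>\<open>reduced_quot\<close> is a homomorphism.\<close>

definition reduced_mult ::
    "('a \<Rightarrow> 'a \<Rightarrow> 'a) \<Rightarrow> ('b \<Rightarrow> 'b \<Rightarrow> 'b) \<Rightarrow> 'a set \<Rightarrow>
     'a + 'a \<times> 'b \<Rightarrow> 'a + 'a \<times> 'b \<Rightarrow> 'a + 'a \<times> 'b" where
  "reduced_mult mX mY I u v =
     (case (u, v) of
        (Inr (x, y), Inr (x', y')) \<Rightarrow> reduced_quot I (mX x x', mY y y')
      | _ \<Rightarrow> Inl (mX (reduced_proj u) (reduced_proj v)))"

definition reduced_unit ::
    "('a \<Rightarrow> 'a) \<Rightarrow> ('b \<Rightarrow> 'b) \<Rightarrow> 'a + 'a \<times> 'b \<Rightarrow> 'a + 'a \<times> 'b" where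
  "reduced_unit lX lY u =
     (case u of Inl z \<Rightarrow> Inl (lX z) | Inr (x, y) \<Rightarrow> Inr (lX x, lY y))"

lemma reduced_mult_unique:
  assumes "topspace Y \<noteq> {}" and "two_sided_ideal X mX I"
  shows "(\<forall>p \<in> topspace X \<times> topspace Y. \<forall>p' \<in> topspace X \<times> topspace Y.
            m (reduced_quot I p) (reduced_quot I p') =
            reduced_quot I (mX (fst p) (fst p'), mY (snd p) (snd p')))
     \<longleftrightarrow> (\<forall>u \<in> reduced_carrier X Y I. \<forall>v \<in> reduced_carrier X Y I.
            m u v = reduced_mult mX mY I u v)" (is "?L \<longleftrightarrow> ?R")
proof -
  have hom: "reduced_mult mX mY I (reduced_quot I p) (reduced_quot I p') =
      reduced_quot I (mX (fst p) (fst p'), mY (snd p) (snd p'))"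
    if "p \<in> topspace X \<times> topspace Y" "p' \<in> topspace X \<times> topspace Y" for p p'
    using that assms(2)
    by (auto simp: reduced_mult_def reduced_quot_def reduced_proj_def two_sided_ideal_def)
  obtain y where y: "y \<in> topspace Y"
    using assms(1) by blast
  have "u \<in> reduced_quot I ` (topspace X \<times> topspace Y)" if u: "u \<in> reduced_carrier X Y I" for u
  proof (cases u)
    case (Inl z)
    then have "z \<in> I" using u by (auto simp: reduced_carrier_def)
    then show ?thesis
      using Inl y assms(2)
      by (intro image_eqI[of _ _ "(z, y)"]) (auto simp: reduced_quot_def two_sided_ideal_def)
  next
    case (Inr p)
    then show ?thesis
      using u by (intro image_eqI[of _ _ p]) (auto simp: reduced_carrier_def reduced_quot_def)
  qed
  moreover have "reduced_quot I ` (topspace X \<times> topspace Y) \<subseteq> reduced_carrier X Y I"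
    by (auto simp: reduced_carrier_def reduced_quot_def)
  ultimately have "reduced_carrier X Y I = reduced_quot I ` (topspace X \<times> topspace Y)"
    by blast
  then show ?thesis
    using hom by simp
qed

lemma
  assumes I: "closedin X I"
  shows reduced_topology_admissible: "reduced_admissible X Y I (reduced_topology X Y I)"
    and reduced_topology_least:
      "reduced_admissible X Y I T' \<Longrightarrow> openin (reduced_topology X Y I) U \<Longrightarrow> openin T' U"
    and openin_reduced_topology:
      "openin (reduced_topology X Y I) U \<longleftrightarrow>
         U \<subseteq> reduced_carrier X Y I \<and>
         openin (prod_topology X Y) (Inr -` U) \<and>
         (\<forall>z. Inl z \<in> U \<longrightarrow> (\<exists>V. openin X V \<and> z \<in> V \<and>
            {u \<in> reduced_carrier X Y I. reduced_proj u \<in> V} \<subseteq> U))"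
proof -
  let ?C = "reduced_carrier X Y I"
  let ?E = "prod_topology (subtopology X (topspace X - I)) Y"
  define P where "P U \<longleftrightarrow> U \<subseteq> ?C \<and> openin (prod_topology X Y) (Inr -` U) \<and>
    (\<forall>z. Inl z \<in> U \<longrightarrow> (\<exists>V. openin X V \<and> z \<in> V \<and> {u \<in> ?C. reduced_proj u \<in> V} \<subseteq> U))"
    for U :: "('a + 'a \<times> 'b) set"
  define T where "T = topology P"
  have IX: "I \<subseteq> topspace X" and D: "openin X (topspace X - I)"
    using I by (auto dest: closedin_subset)
  have E_top: "topspace ?E = (topspace X - I) \<times> topspace Y"
    by auto
  have E_open: "openin ?E A \<longleftrightarrow> openin (prod_topology X Y) A \<and> A \<subseteq> (topspace X - I) \<times> topspace Y"
    for A
  proof -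
    have "?E = subtopology (prod_topology X Y) ((topspace X - I) \<times> topspace Y)"
      by (simp add: subtopology_Times)
    moreover have "openin (prod_topology X Y) ((topspace X - I) \<times> topspace Y)"
      using D by (simp add: openin_prod_Times_iff)
    ultimately show ?thesis
      by (simp add: openin_open_subtopology)
  qed
  have "istopology P"
    unfolding istopology_def
  proof (intro conjI allI impI)
    fix A B assume A: "P A" and B: "P B"
    show "P (A \<inter> B)"
      unfolding P_def
    proof (intro conjI allI impI)
      show "A \<inter> B \<subseteq> ?C" using A by (auto simp: P_def)
      show "openin (prod_topology X Y) (Inr -` (A \<inter> B))"
        using A B by (auto simp: P_def)
      fix z assume "Inl z \<in> A \<inter> B"
      then obtain V V' where "openin X V" "z \<in> V" "{u \<in> ?C. reduced_proj u \<in> V} \<subseteq> A"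
         "openin X V'" "z \<in> V'" "{u \<in> ?C. reduced_proj u \<in> V'} \<subseteq> B"
        using A B unfolding P_def by (meson IntD1 IntD2)
      then show "\<exists>V. openin X V \<and> z \<in> V \<and> {u \<in> ?C. reduced_proj u \<in> V} \<subseteq> A \<inter> B"
        by (intro exI[of _ "V \<inter> V'"]) auto
    qed
  next
    fix K assume K: "\<forall>A\<in>K. P A"
    show "P (\<Union> K)"
      unfolding P_def
    proof (intro conjI allI impI)
      show "\<Union> K \<subseteq> ?C" using K by (auto simp: P_def)
      show "openin (prod_topology X Y) (Inr -` \<Union> K)"
        using K by (auto simp: P_def vimage_Union)
      fix z assume "Inl z \<in> \<Union> K"
      then obtain A where A: "A \<in> K" "Inl z \<in> A" by auto
      then obtain V where "openin X V" "z \<in> V" "{u \<in> ?C. reduced_proj u \<in> V} \<subseteq> A"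
        using K unfolding P_def by meson
      then show "\<exists>V. openin X V \<and> z \<in> V \<and> {u \<in> ?C. reduced_proj u \<in> V} \<subseteq> \<Union> K"
        using A by blast
    qed
  qed
  then have T_open: "openin T U \<longleftrightarrow> P U" for U
    by (simp add: T_def)
  have vim_proj: "Inr -` {u \<in> ?C. reduced_proj u \<in> V} = (V \<inter> (topspace X - I)) \<times> topspace Y"
    for V by (auto simp: reduced_carrier_def reduced_proj_def)
  have P_proj: "P {u \<in> ?C. reduced_proj u \<in> V}" if "openin X V" for V
    unfolding P_def vim_proj using that D
    by (auto simp: openin_prod_Times_iff reduced_proj_def)
  have P_Inr: "P (Inr ` A)" if "openin ?E A" for A
    using that by (auto simp: P_def E_open reduced_carrier_def inj_vimage_image_eq)
  have "P ?C"
  proof -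
    have "?C = {u \<in> ?C. reduced_proj u \<in> topspace X}"
      using IX by (auto simp: reduced_carrier_def reduced_proj_def)
    then show ?thesis using P_proj[of "topspace X"] by simp
  qed
  then have T_top: "topspace T = ?C"
    unfolding topspace_def T_open by (auto simp: P_def)
  have T_adm: "reduced_admissible X Y I T"
    unfolding reduced_admissible_def
  proof (intro conjI)
    show "continuous_map T X reduced_proj"
      unfolding continuous_map_alt T_top T_open
    proof (intro conjI allI impI)
      show "reduced_proj \<in> ?C \<rightarrow> topspace X"
        using IX by (auto simp: reduced_carrier_def reduced_proj_def)
      fix V assume "openin X V"
      then have "P {u \<in> ?C. reduced_proj u \<in> V}" by (rule P_proj)
      then show "P (reduced_proj -` V \<inter> ?C)"
        by (simp add: vimage_def Int_def conj_commute)
    qed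
    have "continuous_map ?E T Inr"
      unfolding continuous_map T_top T_open
    proof (intro conjI allI impI)
      show "Inr ` topspace ?E \<subseteq> ?C" by (auto simp: reduced_carrier_def)
      fix U assume U: "P U"
      have "{x \<in> topspace ?E. Inr x \<in> U} = Inr -` U"
        using U by (auto simp: P_def reduced_carrier_def)
      then show "openin ?E {x \<in> topspace ?E. Inr x \<in> U}"
        using U by (auto simp: E_open P_def reduced_carrier_def)
    qed
    moreover have "open_map ?E T Inr"
      by (simp add: open_map_def T_open P_Inr)
    ultimately show "embedding_map ?E T Inr"
      by (simp add: injective_open_imp_embedding_map)
  qed (rule T_top)
  have T_least: "openin T' U" if T': "reduced_admissible X Y I T'" and U: "openin T U" for T' U
  proof (subst openin_subopen, intro ballI)
    fix u assume u: "u \<in> U"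
    have PU: "P U" using U by (simp add: T_open)
    have pre: "openin T' {u \<in> ?C. reduced_proj u \<in> V}" if "openin X V" for V
      using T' that unfolding reduced_admissible_def
      by (metis openin_continuous_map_preimage)
    show "\<exists>V. openin T' V \<and> u \<in> V \<and> V \<subseteq> U"
    proof (cases u)
      case (Inl z)
      then obtain V where "openin X V" "z \<in> V" "{u \<in> ?C. reduced_proj u \<in> V} \<subseteq> U"
        using PU u unfolding P_def by meson
      moreover have "u \<in> ?C" using PU u by (auto simp: P_def)
      ultimately show ?thesis
        using pre[of V] Inl by (auto simp: reduced_proj_def)
    next
      case (Inr p)
      have im: "Inr ` topspace ?E = {u \<in> ?C. reduced_proj u \<in> topspace X - I}"
        by (auto simp: reduced_carrier_def reduced_proj_def)
      have "openin ?E (Inr -` U)"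
        using PU by (auto simp: E_open P_def reduced_carrier_def)
      moreover have "homeomorphic_map ?E (subtopology T' (Inr ` topspace ?E)) Inr"
        using T' by (simp add: reduced_admissible_def embedding_map_def)
      ultimately have "openin (subtopology T' (Inr ` topspace ?E)) (Inr ` (Inr -` U))"
        by (meson homeomorphic_map_openness homeomorphic_imp_open_map open_map_def)
      moreover have "openin T' (Inr ` topspace ?E)"
        unfolding im using pre D by blast
      ultimately have "openin T' (Inr ` (Inr -` U))"
        by (simp add: openin_open_subtopology)
      then show ?thesis
        using u Inr by (intro exI[of _ "Inr ` (Inr -` U)"]) auto
    qed
  qed
  have eq: "reduced_topology X Y I = T"
    unfolding reduced_topology_def
  proof (rule the_equality)
    show "reduced_admissible X Y I T \<and>
        (\<forall>T'. reduced_admissible X Y I T' \<longrightarrow> (\<forall>U. openin T U \<longrightarrow> openin T' U))"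
      using T_adm T_least by blast
    fix T'' assume "reduced_admissible X Y I T'' \<and>
        (\<forall>T'. reduced_admissible X Y I T' \<longrightarrow> (\<forall>U. openin T'' U \<longrightarrow> openin T' U))"
    then show "T'' = T"
      using T_adm T_least unfolding topology_eq by blast
  qed
  show "reduced_admissible X Y I (reduced_topology X Y I)"
    using T_adm eq by simp
  show "reduced_admissible X Y I T' \<Longrightarrow> openin (reduced_topology X Y I) U \<Longrightarrow> openin T' U"
    using T_least eq by simp
  show "openin (reduced_topology X Y I) U \<longleftrightarrow>
         U \<subseteq> reduced_carrier X Y I \<and>
         openin (prod_topology X Y) (Inr -` U) \<and>
         (\<forall>z. Inl z \<in> U \<longrightarrow> (\<exists>V. openin X V \<and> z \<in> V \<and>
            {u \<in> reduced_carrier X Y I. reduced_proj u \<in> V} \<subseteq> U))"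
    unfolding eq T_open P_def ..
qed

end

theory Submission
  imports Defs
begin

text \<open>
  A map into the reduced product is continuous iff its composition with the projection to \<open>X\<close>
  is continuous and, on the open set where that projection avoids \<open>I\<close>, its \<open>Y\<close>-coordinate is
  continuous. Both conditions are inherited from \<open>X\<close> and \<open>Y\<close> by the multiplication and the unit.
  For dicontinuity, a point of \<open>I\<close> has a neighborhood base of preimages under the projection, so
  the witnesses for \<open>X\<close> pull back; a point off \<open>I\<close> has a neighborhood base of boxes, and products
  of the witnesses for \<open>X\<close> and \<open>Y\<close>, cut down to the complement of \<open>I\<close>, do the job: an
  element whose left unit lies off \<open>I\<close> lies itself off \<open>I\<close>.
\<close>

text \<open>Eliminates the subspace topology on the image of \<open>l\<close>. Its open sets are
  traces of open sets \<open>W\<close> of \<open>S\<close>, an element of such a trace has the form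
  \<open>l b\<close> with \<open>l b \<in> W\<close>, and \<open>l z\<close> lies in the image
  anyway. Witnesses can then be intersected and pulled back inside the whole space.\<close>

lemma dicontinuous_iff:
  "dicontinuous S m l \<longleftrightarrow>
     (\<forall>x\<in>topspace S. \<forall>V. openin S V \<and> x \<in> V \<longrightarrow>
        (\<exists>U W. openin S U \<and> x \<in> U \<and> openin S W \<and> l x \<in> W \<and>
           (\<forall>b\<in>topspace S. \<forall>z\<in>topspace S.
              l b \<in> W \<longrightarrow> m (l b) z \<in> U \<longrightarrow> l z \<in> W \<longrightarrow> z \<in> V)))"
  (is "_ \<longleftrightarrow> (\<forall>x\<in>topspace S. \<forall>V. _ \<longrightarrow> ?Q x V)")
proof -
  have "(\<exists>U W. openin S U \<and> x \<in> U \<and>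
          openin (subtopology S (l ` topspace S)) W \<and> l x \<in> W \<and>
          left_div S m W U \<inter> {z \<in> topspace S. l z \<in> W} \<subseteq> V) \<longleftrightarrow> ?Q x V" (is "?P \<longleftrightarrow> _")
    if x: "x \<in> topspace S" for x V
  proof
    assume ?P
    then obtain U W where UW: "openin S U" "x \<in> U" "openin S W" "l x \<in> W"
      "left_div S m (W \<inter> l ` topspace S) U \<inter> {z \<in> topspace S. l z \<in> W \<inter> l ` topspace S} \<subseteq> V"
      unfolding openin_subtopology by blast
    then show "?Q x V"
      by (intro exI[of _ U] exI[of _ W]) (auto simp: left_div_def)
  next
    assume "?Q x V"
    then obtain U W where UW: "openin S U" "x \<in> U" "openin S W" "l x \<in> W"
      "\<forall>b\<in>topspace S. \<forall>z\<in>topspace S. l b \<in> W \<longrightarrow> m (l b) z \<in> U \<longrightarrow> l z \<in> W \<longrightarrow> z \<in> V"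
      by blast
    then have "openin (subtopology S (l ` topspace S)) (W \<inter> l ` topspace S)"
      unfolding openin_subtopology by blast
    then show ?P
      using UW x by (intro exI[of _ U] exI[of _ "W \<inter> l ` topspace S"]) (auto simp: left_div_def)
  qed
  then show ?thesis
    unfolding dicontinuous_def by (intro ball_cong[OF refl] iff_allI imp_cong[OF refl])
qed

text \<open>The value is unspecified on the copy of \<open>I\<close>, so statements about it are
  restricted to points whose projection avoids \<open>I\<close>.\<close>

abbreviation reduced_snd :: "'a + 'a \<times> 'b \<Rightarrow> 'b" where
  "reduced_snd u \<equiv> snd (projr u)"

lemma reduced_proj_simps [simp]: "reduced_proj (Inl z) = z" "reduced_proj (Inr p) = fst p"
  by (simp_all add: reduced_proj_def)

lemma reduced_carrier_simps [simp]:
  "Inl z \<in> reduced_carrier X Y I \<longleftrightarrow> z \<in> I"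
  "Inr p \<in> reduced_carrier X Y I \<longleftrightarrow> fst p \<in> topspace X - I \<and> snd p \<in> topspace Y"
  by (auto simp: reduced_carrier_def image_iff mem_Times_iff)

lemma reduced_unit_simps [simp]:
  "reduced_unit lX lY (Inl z) = Inl (lX z)"
  "reduced_unit lX lY (Inr p) = Inr (lX (fst p), lY (snd p))"
  by (cases p; simp add: reduced_unit_def)+

lemma reduced_proj_unit: "reduced_proj (reduced_unit lX lY u) = lX (reduced_proj u)"
  by (cases u) auto

lemma reduced_proj_mult:
  "reduced_proj (reduced_mult mX mY I u v) = mX (reduced_proj u) (reduced_proj v)"
  by (auto simp: reduced_mult_def reduced_quot_def split: sum.splits prod.splits)

section \<open>Neighborhood bases and continuity criteria for the reduced topology\<close>

context
  fixes X :: "'a topology" and Y :: "'b topology" and I :: "'a set"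
  assumes I: "closedin X I"
begin

lemma openin_complement: "openin X (topspace X - I)"
  using I by auto

lemma topspace_reduced: "topspace (reduced_topology X Y I) = reduced_carrier X Y I"
  using reduced_topology_admissible[OF I] by (auto simp: reduced_admissible_def)

lemma continuous_map_reduced_proj: "continuous_map (reduced_topology X Y I) X reduced_proj"
  using reduced_topology_admissible[OF I] by (auto simp: reduced_admissible_def)

lemma openin_reduced_proj_vimage:
  assumes "openin X V"
  shows "openin (reduced_topology X Y I) {u \<in> reduced_carrier X Y I. reduced_proj u \<in> V}"
  using openin_continuous_map_preimage[OF continuous_map_reduced_proj assms]
  by (simp add: topspace_reduced)

text \<open>Such a box contains no point \<open>Inl z\<close>, so the neighborhood condition at
  points of \<open>I\<close> is vacuous.\<close>

lemma openin_reduced_Inr: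
  assumes "openin X V" "V \<inter> I = {}" "openin Y W"
  shows "openin (reduced_topology X Y I) (Inr ` (V \<times> W))"
  using assms openin_subset[of X V] openin_subset[of Y W]
  by (auto simp: openin_reduced_topology[OF I] inj_vimage_image_eq openin_prod_Times_iff)

lemma openin_reduced_Inl_base:
  assumes "openin (reduced_topology X Y I) U" "Inl z \<in> U"
  obtains V where "openin X V" "z \<in> V" "{u \<in> reduced_carrier X Y I. reduced_proj u \<in> V} \<subseteq> U"
  using assms by (auto simp: openin_reduced_topology[OF I])

text \<open>A box inside the preimage of \<open>U\<close> under \<open>Inr\<close> misses
  \<open>I\<close> without shrinking: pairing any \<open>v \<in> V\<close> with \<open>y\<close>
  gives a point of \<open>U\<close>, hence of the carrier.\<close>

lemma openin_reduced_Inr_base: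
  assumes U: "openin (reduced_topology X Y I) U" "Inr (x, y) \<in> U"
  obtains V W where "openin X V" "V \<inter> I = {}" "x \<in> V" "openin Y W" "y \<in> W" "Inr ` (V \<times> W) \<subseteq> U"
proof -
  have "openin (prod_topology X Y) (Inr -` U)" and sub: "U \<subseteq> reduced_carrier X Y I"
    using U by (auto simp: openin_reduced_topology[OF I])
  then obtain V W where VW: "openin X V" "x \<in> V" "openin Y W" "y \<in> W" "V \<times> W \<subseteq> Inr -` U"
    using U(2) unfolding openin_prod_topology_alt by (metis vimageI)
  have "Inr ` (V \<times> W) \<subseteq> U"
    using VW by auto
  moreover have "V \<inter> I = {}"
  proof -
    have "v \<notin> I" if "v \<in> V" for v
    proof -
      have "Inr (v, y) \<in> U" using that VW by auto
      then show ?thesis using sub by fastforce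
    qed
    then show ?thesis by auto
  qed
  ultimately show ?thesis
    using that VW by blast
qed

text \<open>Openness of preimages is checked pointwise, because the neighborhood bases differ:
  preimages under the projection at \<open>Inl a\<close>, boxes at \<open>Inr (x, y)\<close>. Only
  the boxes involve the second coordinate.\<close>

lemma continuous_map_into_reduced:
  assumes fC: "\<And>z. z \<in> topspace Z \<Longrightarrow> f z \<in> reduced_carrier X Y I"
    and fX: "continuous_map Z X (\<lambda>z. reduced_proj (f z))"
    and fY: "continuous_map (subtopology Z {z \<in> topspace Z. reduced_proj (f z) \<notin> I}) Y
               (\<lambda>z. reduced_snd (f z))"
  shows "continuous_map Z (reduced_topology X Y I) f"
  unfolding continuous_map
proof (intro conjI allI impI)
  show "f ` topspace Z \<subseteq> topspace (reduced_topology X Y I)"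
    using fC by (auto simp: topspace_reduced)
  fix U assume U: "openin (reduced_topology X Y I) U"
  let ?D = "{z \<in> topspace Z. reduced_proj (f z) \<notin> I}"
  \<comment> \<open>Closedness of \<open>I\<close> enters here. Since \<open>?D\<close> is open,
    sets open in the subspace \<open>?D\<close> are open in \<open>Z\<close>, which makes
    \<open>?N\<close> below open.\<close>
  have D: "openin Z ?D"
  proof -
    have "?D = {z \<in> topspace Z. reduced_proj (f z) \<in> topspace X - I}"
      using continuous_map_image_subset_topspace[OF fX] by auto
    then show ?thesis
      using openin_continuous_map_preimage[OF fX openin_complement] by simp
  qed
  show "openin Z {z \<in> topspace Z. f z \<in> U}"
  proof (subst openin_subopen, intro ballI)
    fix z assume "z \<in> {z \<in> topspace Z. f z \<in> U}"
    then have z: "z \<in> topspace Z" "f z \<in> U" by auto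
    show "\<exists>N. openin Z N \<and> z \<in> N \<and> N \<subseteq> {z \<in> topspace Z. f z \<in> U}"
    proof (cases "f z")
      case (Inl a)
      obtain V where V: "openin X V" "a \<in> V"
        "{u \<in> reduced_carrier X Y I. reduced_proj u \<in> V} \<subseteq> U"
        by (rule openin_reduced_Inl_base[OF U z(2)[unfolded Inl]])
      then show ?thesis
        using openin_continuous_map_preimage[OF fX V(1)] z fC Inl
        by (intro exI[of _ "{z \<in> topspace Z. reduced_proj (f z) \<in> V}"]) auto
    next
      case (Inr p)
      then obtain x y where xy: "f z = Inr (x, y)" by (cases p) auto
      obtain V W where VW: "openin X V" "V \<inter> I = {}" "x \<in> V" "openin Y W" "y \<in> W"
        "Inr ` (V \<times> W) \<subseteq> U"
        by (rule openin_reduced_Inr_base[OF U z(2)[unfolded xy]])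
      let ?N = "{z \<in> topspace Z. reduced_proj (f z) \<in> V} \<inter>
        {z \<in> topspace (subtopology Z ?D). reduced_snd (f z) \<in> W}"
      have "openin Z ?N"
        using openin_continuous_map_preimage[OF fX VW(1)]
          openin_continuous_map_preimage[OF fY VW(4)] D
        by (metis (no_types, lifting) openin_Int openin_open_subtopology)
      moreover have "z \<in> ?N"
        using z xy VW by auto
      moreover have "f w \<in> U" if w: "w \<in> ?N" for w
      \<comment> \<open>The first case is void: a carrier point \<open>Inl a\<close> has
        \<open>a \<in> I\<close>, whereas \<open>w\<close> lies in \<open>?D\<close>.\<close>
      proof (cases "f w")
        case (Inl a)
        then show ?thesis using w fC[of w] by auto
      next
        case (Inr q)
        then show ?thesis using w VW(6) by (cases q) auto
      qed
      ultimately show ?thesis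
        by (intro exI[of _ ?N]) auto
    qed
  qed
qed

text \<open>The preimage of \<open>W\<close> is the open box with sides
  \<open>topspace X - I\<close> and \<open>W\<close>. Composition with this map yields the second
  coordinates of the product and of the unit.\<close>

lemma continuous_map_reduced_snd:
  "continuous_map (subtopology (reduced_topology X Y I)
     {u \<in> reduced_carrier X Y I. reduced_proj u \<notin> I}) Y reduced_snd"
  (is "continuous_map (subtopology ?T ?O) Y _")
  unfolding continuous_map
proof (intro conjI allI impI)
  have O: "?O = Inr ` ((topspace X - I) \<times> topspace Y)"
    by (auto simp: reduced_carrier_def)
  show "reduced_snd ` topspace (subtopology ?T ?O) \<subseteq> topspace Y"
    by (auto simp: O)
  fix W assume W: "openin Y W"
  then have "openin ?T (Inr ` ((topspace X - I) \<times> W))"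
    by (intro openin_reduced_Inr openin_complement) auto
  moreover have "{u \<in> topspace (subtopology ?T ?O). reduced_snd u \<in> W} =
      Inr ` ((topspace X - I) \<times> W) \<inter> ?O"
    using openin_subset[OF W] by (auto simp: O topspace_reduced)
  ultimately show "openin (subtopology ?T ?O) {u \<in> topspace (subtopology ?T ?O). reduced_snd u \<in> W}"
    unfolding openin_subtopology by blast
qed

end

section \<open>Algebra of the reduced product\<close>

locale reduced_product =
  fixes X :: "'a topology" and Y :: "'b topology"
    and mX :: "'a \<Rightarrow> 'a \<Rightarrow> 'a" and mY :: "'b \<Rightarrow> 'b \<Rightarrow> 'b"
    and lX :: "'a \<Rightarrow> 'a" and lY :: "'b \<Rightarrow> 'b"
    and I :: "'a set"
  assumes X: "topological_left_unosemigroup X mX lX"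
    and Y: "topological_left_unosemigroup Y mY lY"
    and I: "closedin X I" and ideal: "two_sided_ideal X mX I" and lI: "lX ` I \<subseteq> I"
begin

abbreviation "C \<equiv> reduced_carrier X Y I"
abbreviation "T \<equiv> reduced_topology X Y I"
abbreviation "m \<equiv> reduced_mult mX mY I"
abbreviation "l \<equiv> reduced_unit lX lY"

lemma continuous_mX: "continuous_map (prod_topology X X) X (\<lambda>(x, y). mX x y)"
  and continuous_mY: "continuous_map (prod_topology Y Y) Y (\<lambda>(x, y). mY x y)"
  and continuous_lX: "continuous_map X X lX"
  and continuous_lY: "continuous_map Y Y lY"
  using X Y by (auto simp: topological_left_unosemigroup_def topological_semigroup_def)

lemma mX_closed: "x \<in> topspace X \<Longrightarrow> y \<in> topspace X \<Longrightarrow> mX x y \<in> topspace X"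
  using continuous_map_image_subset_topspace[OF continuous_mX] by auto

lemma mY_closed: "x \<in> topspace Y \<Longrightarrow> y \<in> topspace Y \<Longrightarrow> mY x y \<in> topspace Y"
  using continuous_map_image_subset_topspace[OF continuous_mY] by auto

lemma lX_closed: "x \<in> topspace X \<Longrightarrow> lX x \<in> topspace X"
  using continuous_map_image_subset_topspace[OF continuous_lX] by auto

lemma lY_closed: "x \<in> topspace Y \<Longrightarrow> lY x \<in> topspace Y"
  using continuous_map_image_subset_topspace[OF continuous_lY] by auto

lemma ideal_left: "x \<in> topspace X \<Longrightarrow> z \<in> I \<Longrightarrow> mX x z \<in> I"
  and ideal_right: "x \<in> topspace X \<Longrightarrow> z \<in> I \<Longrightarrow> mX z x \<in> I"
  using ideal by (auto simp: two_sided_ideal_def)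

lemma lX_mult: "x \<in> topspace X \<Longrightarrow> mX (lX x) x = x"
  and lY_mult: "y \<in> topspace Y \<Longrightarrow> mY (lY y) y = y"
  using X Y by (auto simp: topological_left_unosemigroup_def)

text \<open>If \<open>lX x\<close> lies in the ideal, then so does \<open>x\<close>, being the
  product of \<open>lX x\<close> and \<open>x\<close>.\<close>

lemma lX_in_I_iff: "x \<in> topspace X \<Longrightarrow> lX x \<in> I \<longleftrightarrow> x \<in> I"
  using ideal_right[of x "lX x"] lX_mult lI by auto

lemma proj_in: "u \<in> C \<Longrightarrow> reduced_proj u \<in> topspace X"
  using closedin_subset[OF I] by (cases u) auto

lemma mult_Inr: "m (Inr p) (Inr p') = reduced_quot I (mX (fst p) (fst p'), mY (snd p) (snd p'))"
  by (simp add: reduced_mult_def split: prod.splits)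

lemma mult_Inl: "m (Inl z) v = Inl (mX z (reduced_proj v))" "m u (Inl z) = Inl (mX (reduced_proj u) z)"
  by (auto simp: reduced_mult_def split: sum.splits)

lemma mult_closed: "u \<in> C \<Longrightarrow> v \<in> C \<Longrightarrow> m u v \<in> C"
  by (cases u; cases v)
    (auto simp: mult_Inr mult_Inl reduced_quot_def mX_closed mY_closed ideal_left ideal_right
      subsetD[OF closedin_subset[OF I]])

lemma unit_closed: "u \<in> C \<Longrightarrow> l u \<in> C"
  using lI by (cases u) (auto simp: lX_closed lY_closed lX_in_I_iff)

text \<open>The ideal absorbs from both sides, so a product off \<open>I\<close> has both factors
  off \<open>I\<close>. There \<open>m\<close> is the coordinatewise product.\<close>

lemma mult_notin_I:
  assumes "u \<in> C" "v \<in> C" "mX (reduced_proj u) (reduced_proj v) \<notin> I"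
  shows "reduced_proj u \<notin> I" "reduced_proj v \<notin> I"
    "reduced_snd (m u v) = mY (reduced_snd u) (reduced_snd v)"
proof -
  show u: "reduced_proj u \<notin> I" and v: "reduced_proj v \<notin> I"
    using assms ideal_left ideal_right proj_in by blast+
  show "reduced_snd (m u v) = mY (reduced_snd u) (reduced_snd v)"
    using assms u v by (cases u; cases v) (auto simp: mult_Inr reduced_quot_def)
qed

text \<open>A carrier point is determined by its projection together with, off \<open>I\<close>, its
  second coordinate. Comparing these two data avoids splitting all three factors into cases.\<close>

lemma mult_assoc:
  assumes "u \<in> C" "v \<in> C" "w \<in> C"
  shows "m (m u v) w = m u (m v w)"
proof -
  have aX: "mX (mX x y) z = mX x (mX y z)"
    if "x \<in> topspace X" "y \<in> topspace X" "z \<in> topspace X" for x y z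
    using X that by (auto simp: topological_left_unosemigroup_def topological_semigroup_def)
  have aY: "mY (mY x y) z = mY x (mY y z)"
    if "x \<in> topspace Y" "y \<in> topspace Y" "z \<in> topspace Y" for x y z
    using Y that by (auto simp: topological_left_unosemigroup_def topological_semigroup_def)
  have eq: "u = v" if "u \<in> C" "v \<in> C" "reduced_proj u = reduced_proj v"
    "reduced_proj u \<notin> I \<Longrightarrow> reduced_snd u = reduced_snd v" for u v
    using that by (cases u; cases v) (auto simp: prod_eq_iff)
  have projs: "reduced_proj (m (m u v) w) = reduced_proj (m u (m v w))"
    using assms by (simp add: reduced_proj_mult aX proj_in)
  show ?thesis
  proof (rule eq)
    \<comment> \<open>A triple product off \<open>I\<close> has all its factors and partial products
      off \<open>I\<close>, so both second coordinates are computed in \<open>Y\<close>. The facts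
      \<open>L\<close> and \<open>R\<close> treat the outer products, \<open>L'\<close> and
      \<open>R'\<close> the inner ones.\<close>
    assume n: "reduced_proj (m (m u v) w) \<notin> I"
    note n' = n[unfolded projs]
    have 1: "mX (reduced_proj (m u v)) (reduced_proj w) \<notin> I"
      "mX (reduced_proj u) (reduced_proj (m v w)) \<notin> I"
      using n n' by (simp_all add: reduced_proj_mult)
    note L = mult_notin_I[OF mult_closed[OF assms(1,2)] assms(3) 1(1)]
    note R = mult_notin_I[OF assms(1) mult_closed[OF assms(2,3)] 1(2)]
    note L' = mult_notin_I[OF assms(1,2) L(1)[unfolded reduced_proj_mult]]
    note R' = mult_notin_I[OF assms(2,3) R(2)[unfolded reduced_proj_mult]]
    have "reduced_snd a \<in> topspace Y" if "a \<in> C" "reduced_proj a \<notin> I" for a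
      using that by (cases a) auto
    then show "reduced_snd (m (m u v) w) = reduced_snd (m u (m v w))"
      using assms L(2) L'(1,2) by (simp add: L(3) R(3) L'(3) R'(3) aY)
  qed (use assms projs mult_closed in auto)
qed

lemma unit_mult: "u \<in> C \<Longrightarrow> m (l u) u = u"
  using closedin_subset[OF I]
  by (cases u) (auto simp: mult_Inl mult_Inr lX_mult lY_mult reduced_quot_def)

section \<open>Continuity of the operations\<close>

lemma continuous_mult: "continuous_map (prod_topology T T) T (\<lambda>(u, v). m u v)"
proof (rule continuous_map_into_reduced[OF I])
  let ?D = "{p \<in> topspace (prod_topology T T). reduced_proj (case p of (u, v) \<Rightarrow> m u v) \<notin> I}"
  let ?O = "{u \<in> C. reduced_proj u \<notin> I}"
  show "(case p of (u, v) \<Rightarrow> m u v) \<in> C" if "p \<in> topspace (prod_topology T T)" for p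
    using that mult_closed by (auto simp: topspace_reduced[OF I])
  have "continuous_map (prod_topology T T) X (\<lambda>p. mX (reduced_proj (fst p)) (reduced_proj (snd p)))"
    using continuous_map_compose[OF _ continuous_mX,
        of "prod_topology T T" "\<lambda>p. (reduced_proj (fst p), reduced_proj (snd p))"]
      continuous_map_compose[OF continuous_map_fst continuous_map_reduced_proj[OF I]]
      continuous_map_compose[OF continuous_map_snd continuous_map_reduced_proj[OF I]]
    by (auto simp: continuous_map_pairwise o_def)
  then show "continuous_map (prod_topology T T) X (\<lambda>p. reduced_proj (case p of (u, v) \<Rightarrow> m u v))"
    by (simp add: case_prod_unfold reduced_proj_mult)
  \<comment> \<open>Where the product avoids \<open>I\<close>, both factors lie in
    \<open>?O\<close>, the domain on which \<open>reduced_snd\<close> is continuous.\<close>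
  have D: "?D \<subseteq> ?O \<times> ?O"
    using mult_notin_I by (auto simp: topspace_reduced[OF I] reduced_proj_mult)
  have f: "continuous_map (subtopology (prod_topology T T) ?D) (subtopology T ?O) fst"
    "continuous_map (subtopology (prod_topology T T) ?D) (subtopology T ?O) snd"
    using D by (auto simp: continuous_map_in_subtopology
        intro!: continuous_map_from_subtopology continuous_map_fst continuous_map_snd)
  have "continuous_map (subtopology (prod_topology T T) ?D) Y
      (\<lambda>p. mY (reduced_snd (fst p)) (reduced_snd (snd p)))"
    using continuous_map_compose[OF _ continuous_mY, of "subtopology (prod_topology T T) ?D"
        "\<lambda>p. (reduced_snd (fst p), reduced_snd (snd p))"]
      continuous_map_compose[OF f(1) continuous_map_reduced_snd[OF I]]
      continuous_map_compose[OF f(2) continuous_map_reduced_snd[OF I]]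
    by (auto simp: continuous_map_pairwise o_def)
  then show "continuous_map (subtopology (prod_topology T T) ?D) Y
      (\<lambda>p. reduced_snd (case p of (u, v) \<Rightarrow> m u v))"
    by (rule continuous_map_eq)
      (auto simp: topspace_reduced[OF I] reduced_proj_mult mult_notin_I(3))
qed

lemma continuous_unit: "continuous_map T T l"
proof (rule continuous_map_into_reduced[OF I])
  let ?D = "{u \<in> topspace T. reduced_proj (l u) \<notin> I}"
  show "l u \<in> C" if "u \<in> topspace T" for u
    using that unit_closed by (simp add: topspace_reduced[OF I])
  show "continuous_map T X (\<lambda>u. reduced_proj (l u))"
    using continuous_map_compose[OF continuous_map_reduced_proj[OF I] continuous_lX]
    by (simp add: reduced_proj_unit o_def)
  \<comment> \<open>The unit leaves \<open>I\<close> exactly where its argument does, so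
    \<open>?D\<close> is the domain of continuity of \<open>reduced_snd\<close>.\<close>
  have D: "?D = {u \<in> C. reduced_proj u \<notin> I}"
    using proj_in lX_in_I_iff by (auto simp: topspace_reduced[OF I] reduced_proj_unit)
  have "continuous_map (subtopology T ?D) Y (\<lambda>u. lY (reduced_snd u))"
    unfolding D using continuous_map_compose[OF continuous_map_reduced_snd[OF I] continuous_lY]
    by (simp add: o_def)
  moreover have "lY (reduced_snd u) = reduced_snd (l u)" if "u \<in> topspace (subtopology T ?D)" for u
    using that by (cases u) (auto simp: D)
  ultimately show "continuous_map (subtopology T ?D) Y (\<lambda>u. reduced_snd (l u))"
    by (rule continuous_map_eq)
qed

lemma unosemigroup: "topological_left_unosemigroup T m l"
proof -
  obtain x y where "x \<in> topspace X" "y \<in> topspace Y"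
    using X Y unfolding topological_left_unosemigroup_def topological_semigroup_def by blast
  then have "(if x \<in> I then Inl x else Inr (x, y)) \<in> C"
    by auto
  then have "topspace T \<noteq> {}"
    unfolding topspace_reduced[OF I] by blast
  then show ?thesis
    unfolding topological_left_unosemigroup_def topological_semigroup_def
    using continuous_mult continuous_unit mult_assoc unit_mult
    by (simp add: topspace_reduced[OF I])
qed

section \<open>Dicontinuity of the unit\<close>

lemma dicontinuous:
  assumes dX: "dicontinuous X mX lX" and dY: "dicontinuous Y mY lY"
  shows "dicontinuous T m l"
  unfolding dicontinuous_iff topspace_reduced[OF I]
proof (intro ballI allI impI)
  fix u V assume u: "u \<in> C" and "openin T V \<and> u \<in> V"
  then have V: "openin T V" "u \<in> V" by auto
  let ?goal = "\<exists>U W. openin T U \<and> u \<in> U \<and> openin T W \<and> l u \<in> W \<and>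
    (\<forall>b\<in>C. \<forall>z\<in>C. l b \<in> W \<longrightarrow> m (l b) z \<in> U \<longrightarrow> l z \<in> W \<longrightarrow> z \<in> V)"
  show ?goal
  proof (cases u)
    case (Inl z)
    obtain V' where V': "openin X V'" "z \<in> V'" "{u \<in> C. reduced_proj u \<in> V'} \<subseteq> V"
      by (rule openin_reduced_Inl_base[OF I V(1) V(2)[unfolded Inl]])
    have z: "z \<in> topspace X" using proj_in[OF u] Inl by simp
    obtain U W where UW: "openin X U" "z \<in> U" "openin X W" "lX z \<in> W"
      "\<forall>b\<in>topspace X. \<forall>z\<in>topspace X. lX b \<in> W \<longrightarrow> mX (lX b) z \<in> U \<longrightarrow> lX z \<in> W \<longrightarrow> z \<in> V'"
      using dX[unfolded dicontinuous_iff, rule_format, OF z conjI[OF V'(1,2)]] by blast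
    \<comment> \<open>The projection commutes with products and units, so the implication for
      \<open>U\<close> and \<open>W\<close> in \<open>X\<close> transfers and gives a projection in
      \<open>V'\<close>.\<close>
    let ?U = "{u \<in> C. reduced_proj u \<in> U}"
    let ?W = "{u \<in> C. reduced_proj u \<in> W}"
    have "openin T ?U" "openin T ?W"
      using UW by (auto intro: openin_reduced_proj_vimage[OF I])
    moreover have "u \<in> ?U" "l u \<in> ?W"
      using UW u unit_closed[OF u] Inl by auto
    moreover have "w \<in> V" if "b \<in> C" "w \<in> C" "l b \<in> ?W" "m (l b) w \<in> ?U" "l w \<in> ?W" for b w
      using that UW(5) V'(3) proj_in by (auto simp: reduced_proj_mult reduced_proj_unit)
    ultimately show ?goal by blast
  next
    case (Inr p)
    then obtain x y where xy: "u = Inr (x, y)" by (cases p) auto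
    then have mem: "x \<in> topspace X" "x \<notin> I" "y \<in> topspace Y"
      using u by auto
    obtain Vx Vy where Vxy: "openin X Vx" "Vx \<inter> I = {}" "x \<in> Vx" "openin Y Vy" "y \<in> Vy"
      "Inr ` (Vx \<times> Vy) \<subseteq> V"
      by (rule openin_reduced_Inr_base[OF I V(1) V(2)[unfolded xy]])
    obtain Ux Wx where UWx: "openin X Ux" "x \<in> Ux" "openin X Wx" "lX x \<in> Wx"
      "\<And>b z. b \<in> topspace X \<Longrightarrow> z \<in> topspace X \<Longrightarrow> lX b \<in> Wx \<Longrightarrow> mX (lX b) z \<in> Ux \<Longrightarrow>
         lX z \<in> Wx \<Longrightarrow> z \<in> Vx"
      using dX[unfolded dicontinuous_iff, rule_format, OF mem(1) conjI[OF Vxy(1,3)]] by blast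
    obtain Uy Wy where UWy: "openin Y Uy" "y \<in> Uy" "openin Y Wy" "lY y \<in> Wy"
      "\<And>b z. b \<in> topspace Y \<Longrightarrow> z \<in> topspace Y \<Longrightarrow> lY b \<in> Wy \<Longrightarrow> mY (lY b) z \<in> Uy \<Longrightarrow>
         lY z \<in> Wy \<Longrightarrow> z \<in> Vy"
      using dY[unfolded dicontinuous_iff, rule_format, OF mem(3) conjI[OF Vxy(4,5)]] by blast
    \<comment> \<open>Removing \<open>I\<close> makes the boxes open in \<open>T\<close>. They still
      contain \<open>u\<close> and \<open>l u\<close>, since \<open>x \<notin> I\<close> gives
      \<open>lX x \<notin> I\<close>.\<close>
    let ?U = "Inr ` ((Ux \<inter> (topspace X - I)) \<times> Uy) :: ('a + 'a \<times> 'b) set"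
    let ?W = "Inr ` ((Wx \<inter> (topspace X - I)) \<times> Wy) :: ('a + 'a \<times> 'b) set"
    have "openin T ?U" "openin T ?W"
      using UWx UWy openin_complement[OF I]
      by (auto intro!: openin_reduced_Inr[OF I])
    moreover have "u \<in> ?U" "l u \<in> ?W"
      using xy mem UWx UWy by (auto simp: lX_closed lX_in_I_iff)
    moreover have "z \<in> V" if b: "b \<in> C" and z: "z \<in> C" and lb: "l b \<in> ?W"
      and mU: "m (l b) z \<in> ?U" and lz: "l z \<in> ?W" for b z
    proof -
      \<comment> \<open>The unit respects the two summands, so \<open>l b\<close> and
        \<open>l z\<close> in \<open>?W\<close> force \<open>b\<close> and \<open>z\<close> to be
        pairs. As \<open>m (l b) z\<close> is a pair too, \<open>reduced_quot\<close> takes its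
        second branch and the membership in \<open>?U\<close> splits by coordinates.\<close>
      obtain b1 b2 where b': "b = Inr (b1, b2)" using lb by (cases b) auto
      obtain z1 z2 where z': "z = Inr (z1, z2)" using lz by (cases z) auto
      have "mX (lX b1) z1 \<in> Ux" "mY (lY b2) z2 \<in> Uy"
        using mU b' z' by (auto simp: mult_Inr reduced_quot_def split: if_splits)
      then have "z1 \<in> Vx" "z2 \<in> Vy"
        using UWx(5)[of b1 z1] UWy(5)[of b2 z2] b z lb lz b' z' by auto
      then show ?thesis using Vxy(6) z' by auto
    qed
    ultimately show ?goal by blast
  qed
qed

end

theorem theorem5:
  fixes X :: "'a topology" and Y :: "'b topology"
    and mX :: "'a \<Rightarrow> 'a \<Rightarrow> 'a" and mY :: "'b \<Rightarrow> 'b \<Rightarrow> 'b"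
    and lX :: "'a \<Rightarrow> 'a" and lY :: "'b \<Rightarrow> 'b"
    and I :: "'a set"
  assumes "topological_left_unosemigroup X mX lX"
    and "topological_left_unosemigroup Y mY lY"
    and "closedin X I" and "two_sided_ideal X mX I" and "lX ` I \<subseteq> I"
    and "ditopological_left_unosemigroup X mX lX"
    and "ditopological_left_unosemigroup Y mY lY"
  shows "ditopological_left_unosemigroup
           (reduced_topology X Y I) (reduced_mult mX mY I) (reduced_unit lX lY)"
proof -
  interpret reduced_product X Y mX mY lX lY I
    using assms(1-5) by unfold_locales
  show ?thesis
    using assms(6,7) unosemigroup dicontinuous
    by (simp add: ditopological_left_unosemigroup_def)
qed

end
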